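(* Let $X$ be a non-empty set and let $\eta: X\times X \to [0,\infty]$ be a function satisfying $\eta(u,x)\leq \eta(u,z)+\eta(z,x)$ for all $u,x,z\in X$. Consider a point $x \in X$ and a function $\varphi: X \to [0,\infty]$ such that $0 < \varphi(x) < \infty$. Then there exist an $N \in \mathbb{N}\cup \{\infty\}$ and points $(u_k)_{k = 1}^{N}$ in $X$ such that $u_1 = x$; that (i) $\varphi(u_{j}) + \eta(u_{j},u_k) <\varphi(u_k)$ for each $j, k \in \mathbb{N}$ with $1 \leq k < j \leq N$; and (ii) for each $\varepsilon \in (0, \varphi(x))$ there is an index $n = n(\varepsilon) \in \mathbb{N}$ with $n\leq N$ such that $$\varphi(u') + \eta(u',u_{k}) > \varphi(u_{k}) - \varepsilon \quad \mbox{whenever } u'\in X \mbox{ and } k \in \mathbb{N} \mbox{ with } N \geq k \geq n.$$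
   Context: $\mathbb{N}=\{1,2,\dots\}$. If $N=\infty$, then $(u_k)_{k=1}^N$ denotes an infinite sequence indexed by $\mathbb{N}$, and $j\le N$, $k\leq N$ hold for all $j,k\in\mathbb{N}$. *)

theory Defs
  imports Complex_Main "HOL-Library.FuncSet" "HOL-Library.Extended_Real" "HOL-Library.Extended_Nat"
begin

end

theory Submission imports Defs begin

text \<open>Call \<open>v\<close> an improvement of \<open>w\<close> if \<open>\<phi> v + \<eta> (v, w) < \<phi> w\<close>; by the triangle inequality this
relation is transitive. Starting from \<open>x\<close>, repeatedly pass to an improvement that realises more than
half of the best possible gain, stopping when no improvement exists. If the process never stops,
the real numbers \<open>\<phi> (u k)\<close> decrease and are bounded below, so the realised gains, and
hence the best possible ones, tend to \<open>0\<close>.\<close>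

text \<open>The midpoint of \<open>c\<close> and the infimum of \<open>g\<close> lies strictly above
  the infimum, so some value of \<open>g\<close> falls below it. The last conclusion says that the
  gain \<open>c - g v\<close> is at least half of any gain \<open>c - g v'\<close>; written without
  subtraction, it also covers \<open>g v' = \<infinity>\<close>.\<close>

lemma exists_half_infimum:
  fixes g :: "'a \<Rightarrow> ereal"
  assumes nonneg: "\<And>v. v \<in> X \<Longrightarrow> 0 \<le> g v"
    and c: "c < \<infinity>" and w: "w \<in> X" "g w < c"
  obtains v where "v \<in> X" "g v < c" "\<And>v'. v' \<in> X \<Longrightarrow> 2 * g v \<le> c + g v'"
proof -
  define m where "m = (INF v\<in>X. g v)"
  have m_le: "m \<le> g v" if "v \<in> X" for v
    unfolding m_def using that by (rule INF_lower)
  have m0: "0 \<le> m"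
    unfolding m_def using nonneg by (rule INF_greatest)
  have mc: "m < c"
    using m_le[OF w(1)] w(2) by order
  obtain c' where c': "c = ereal c'"
    using c mc m0 by (cases c) auto
  obtain m' where m': "m = ereal m'"
    using mc m0 c' by (cases m) auto
  have "m < ereal ((m' + c') / 2)"
    using mc by (simp add: m' c')
  then obtain v where v: "v \<in> X" "g v < ereal ((m' + c') / 2)"
    unfolding m_def INF_less_iff by blast
  obtain r where r: "g v = ereal r"
    using v nonneg[OF v(1)] by (cases "g v") auto
  show thesis
  proof
    show "v \<in> X" by (fact v(1))
    show "g v < c"
      using v(2) mc by (simp add: r c' m')
    fix v' assume "v' \<in> X"
    then have "ereal m' \<le> g v'"
      using m_le m' by simp
    then show "2 * g v \<le> c + g v'"
      using v(2) by (cases "g v'") (simp_all add: r c')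
  qed
qed

lemma improvement_trans:
  fixes \<eta> :: "'a \<times> 'a \<Rightarrow> ereal" and \<phi> :: "'a \<Rightarrow> ereal"
  assumes "\<eta> (a, c) \<le> \<eta> (a, b) + \<eta> (b, c)"
    and "\<phi> a + \<eta> (a, b) < \<phi> b" and "\<phi> b + \<eta> (b, c) < \<phi> c"
  shows "\<phi> a + \<eta> (a, c) < \<phi> c"
proof -
  have "\<phi> a + \<eta> (a, c) \<le> \<phi> a + \<eta> (a, b) + \<eta> (b, c)"
    using add_left_mono[OF assms(1), of "\<phi> a"] by (simp add: add.assoc)
  also have "\<dots> \<le> \<phi> b + \<eta> (b, c)"
    using assms(2) by (intro add_right_mono) simp
  finally show ?thesis
    using assms(3) by order
qed

text \<open>Both \<open>a n\<close> and \<open>a (Suc n)\<close> tend to the same limit. This will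
  be applied to the values of \<open>\<phi>\<close> along an infinite sequence of
  improvements.\<close>

lemma decseq_nonneg_increments_small:
  fixes a :: "nat \<Rightarrow> real"
  assumes "decseq a" and "\<And>n. 0 \<le> a n" and "0 < e"
  obtains M where "\<And>n. M \<le> n \<Longrightarrow> a n - a (Suc n) < e"
proof -
  obtain L where L: "a \<longlonglongrightarrow> L"
    using decseq_convergent[OF assms(1)] assms(2) by blast
  have "(\<lambda>n. a n - a (Suc n)) \<longlonglongrightarrow> L - L"
    using L by (intro tendsto_diff LIMSEQ_Suc)
  then have "eventually (\<lambda>n. a n - a (Suc n) < e) sequentially"
    using assms(3) by (intro order_tendstoD(2)) simp_all
  then show thesis
    using that unfolding eventually_sequentially by blast
qed

theorem theorem2p5:
  fixes X :: "'a set" and \<eta> :: "'a \<times> 'a \<Rightarrow> ereal" and \<phi> :: "'a \<Rightarrow> ereal" and x :: 'a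
  assumes "X \<noteq> {}"
    and "\<eta> \<in> X \<times> X \<rightarrow> {0..\<infinity>}"
    and "\<And>u z w. u \<in> X \<Longrightarrow> z \<in> X \<Longrightarrow> w \<in> X \<Longrightarrow> \<eta> (u, w) \<le> \<eta> (u, z) + \<eta> (z, w)"
    and "x \<in> X"
    and "\<phi> \<in> X \<rightarrow> {0..\<infinity>}"
    and "0 < \<phi> x" and "\<phi> x < \<infinity>"
  shows "\<exists>(N::enat) (u :: nat \<Rightarrow> 'a).
      1 \<le> N \<and>
      (\<forall>k::nat. 1 \<le> k \<and> enat k \<le> N \<longrightarrow> u k \<in> X) \<and>
      u 1 = x \<and>
      (\<forall>j k :: nat. 1 \<le> k \<and> k < j \<and> enat j \<le> N \<longrightarrow> \<phi> (u j) + \<eta> (u j, u k) < \<phi> (u k)) \<and>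
      (\<forall>\<epsilon>::real. 0 < \<epsilon> \<and> ereal \<epsilon> < \<phi> x \<longrightarrow>
        (\<exists>n::nat. 1 \<le> n \<and> enat n \<le> N \<and>
          (\<forall>u'\<in>X. \<forall>k::nat. n \<le> k \<and> enat k \<le> N \<longrightarrow>
            \<phi> u' + \<eta> (u', u k) > \<phi> (u k) - ereal \<epsilon>)))"
proof -
  have eta0: "0 \<le> \<eta> (v, w)" if "v \<in> X" "w \<in> X" for v w
    using assms(2) that by fastforce
  have phi0: "0 \<le> \<phi> v" if "v \<in> X" for v
    using assms(5) that by fastforce
  \<comment> \<open>The current point comes first, so that \<open>g w\<close> is the function to be
    nearly minimised over the candidates \<open>v\<close>.\<close>
  define g where "g w v = \<phi> v + \<eta> (v, w)" for w v
  have g0: "0 \<le> g w v" if "v \<in> X" "w \<in> X" for v w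
    using that by (simp add: g_def eta0 phi0)
  have phi_le_g: "\<phi> v \<le> g w v" if "v \<in> X" "w \<in> X" for v w
    using add_left_mono[OF eta0[OF that], of "\<phi> v"] by (simp add: g_def)
  define P where "P w v \<longleftrightarrow> v \<in> X \<and> g w v < \<phi> w \<and> (\<forall>v'\<in>X. 2 * g w v \<le> \<phi> w + g w v')" for w v
  define improvable where "improvable w \<longleftrightarrow> (\<exists>v\<in>X. g w v < \<phi> w)" for w
  \<comment> \<open>The choice is arbitrary when no improvement of \<open>w\<close> exists. The
    iteration \<open>s\<close> runs on regardless, so facts about it assume that the earlier terms
    are improvable.\<close>
  define nxt where "nxt w = (SOME v. P w v)" for w
  define s where "s n = (nxt ^^ n) x" for n
  have s0: "s 0 = x" and s_Suc: "s (Suc n) = nxt (s n)" for n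
    by (simp_all add: s_def)
  have nxt: "P w (nxt w)" if w: "w \<in> X" "\<phi> w < \<infinity>" "improvable w" for w
  proof -
    obtain z where "z \<in> X" "g w z < \<phi> w"
      using w(3) by (auto simp: improvable_def)
    with w g0 obtain v
      where "v \<in> X" "g w v < \<phi> w" "\<And>v'. v' \<in> X \<Longrightarrow> 2 * g w v \<le> \<phi> w + g w v'"
      using exists_half_infimum[of X "g w" "\<phi> w" z] by blast
    then have "P w v"
      by (simp add: P_def)
    then show ?thesis
      unfolding nxt_def by (rule someI)
  qed
  \<comment> \<open>Membership and finiteness go through one induction, since \<open>nxt\<close>
    needs both. Finiteness is inherited because \<open>\<phi> v \<le> g w v < \<phi> w\<close> for
    an improvement \<open>v\<close> of \<open>w\<close>.\<close>
  have s_mem: "s n \<in> X \<and> \<phi> (s n) < \<infinity>" if "\<forall>i<n. improvable (s i)" for n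
    using that
  proof (induction n)
    case 0
    then show ?case using assms by (simp add: s0)
  next
    case (Suc n)
    then have mem: "s n \<in> X" "\<phi> (s n) < \<infinity>" by simp_all
    then have "P (s n) (s (Suc n))"
      using Suc.prems nxt by (simp add: s_Suc)
    then have "s (Suc n) \<in> X" "g (s n) (s (Suc n)) < \<phi> (s n)"
      by (simp_all add: P_def)
    then show ?case
      using phi_le_g[of "s (Suc n)" "s n"] mem by (metis order.strict_trans order.strict_trans1)
  qed
  have s_step: "P (s n) (s (Suc n))" if "\<forall>i\<le>n. improvable (s i)" for n
    using s_mem[of n] nxt[of "s n"] that by (simp add: s_Suc)
  \<comment> \<open>Induction on the gap: transitivity extends the single steps to all pairs of
    indices.\<close>
  have s_decr: "g (s k) (s (Suc (k + d))) < \<phi> (s k)" if "\<forall>i<Suc (k + d). improvable (s i)" for k d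
    using that
  proof (induction d)
    case 0
    then show ?case using s_step[of k] by (simp add: P_def)
  next
    case (Suc d)
    have mem: "s k \<in> X" "s (Suc (k + d)) \<in> X" "s (Suc (Suc (k + d))) \<in> X"
      using s_mem[of k] s_mem[of "Suc (k + d)"] s_mem[of "Suc (Suc (k + d))"] Suc.prems by auto
    have "g (s (Suc (k + d))) (s (Suc (Suc (k + d)))) < \<phi> (s (Suc (k + d)))"
      using s_step[of "Suc (k + d)"] Suc.prems by (simp add: P_def)
    moreover have "g (s k) (s (Suc (k + d))) < \<phi> (s k)"
      using Suc by simp
    ultimately show ?case
      using improvement_trans[OF assms(3)[OF mem(3,2,1)], of \<phi>] by (simp add: g_def)
  qed
  \<comment> \<open>The iteration starts at index 0, the required sequence at index 1.\<close>
  define u where "u k = s (k - 1)" for k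
  have chain: "\<phi> (u j) + \<eta> (u j, u k) < \<phi> (u k)"
    if "1 \<le> k" "k < j" "\<forall>i<j - 1. improvable (s i)" for j k
  proof -
    have eq: "Suc (k - 1 + (j - Suc k)) = j - 1"
      using that(1,2) by simp
    show ?thesis
      using s_decr[of "k - 1" "j - Suc k", unfolded eq] that(3) by (simp add: u_def g_def)
  qed
  show ?thesis
  proof (cases "\<forall>n. improvable (s n)")
    case True
    have mem: "s n \<in> X" "\<phi> (s n) < \<infinity>" for n
      using s_mem True by auto
    define a where "a n = real_of_ereal (\<phi> (s n))" for n
    have a: "\<phi> (s n) = ereal (a n)" for n
      using mem[of n] phi0[of "s n"] unfolding a_def by (cases "\<phi> (s n)") auto
    have a0: "0 \<le> a n" for n
      using phi0[of "s n"] mem by (simp add: a)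
    have g_step: "g (s n) (s (Suc n)) < \<phi> (s n)"
      and g_half: "v' \<in> X \<Longrightarrow> 2 * g (s n) (s (Suc n)) \<le> \<phi> (s n) + g (s n) v'"
      and a_le_g: "ereal (a (Suc n)) \<le> g (s n) (s (Suc n))" for n v'
      using s_step[of n] True phi_le_g[of "s (Suc n)" "s n"] mem by (auto simp: P_def a)
    have "a (Suc n) \<le> a n" for n
      using order.strict_trans1[OF a_le_g g_step, of n] by (simp add: a)
    then have decr: "decseq a"
      by (simp add: decseq_Suc_iff)
    have small: "\<exists>n. 1 \<le> n \<and> (\<forall>u'\<in>X. \<forall>k\<ge>n. \<phi> (u k) - ereal \<epsilon> < \<phi> u' + \<eta> (u', u k))"
      if eps: "0 < \<epsilon>" for \<epsilon> :: real
    proof -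
      obtain M where M: "\<And>n. M \<le> n \<Longrightarrow> a n - a (Suc n) < \<epsilon> / 2"
        using decseq_nonneg_increments_small[OF decr a0, of "\<epsilon> / 2"] eps by auto
      \<comment> \<open>For finite \<open>g (s n) v'\<close>, the half-gain property gives \<open>g
        (s n) v' \<ge> 2 * r - a n \<ge> a n - 2 * (a n - a (Suc n))\<close>, where \<open>r\<close>
        is the value of \<open>g (s n)\<close> at the next term. The factor 2 is why
        \<open>M\<close> was chosen for \<open>\<epsilon> / 2\<close>.\<close>
      have "\<phi> (s n) - ereal \<epsilon> < g (s n) v'" if "M \<le> n" "v' \<in> X" for n v'
      proof -
        obtain r where r: "g (s n) (s (Suc n)) = ereal r"
          using g_step[of n] a_le_g[of n] by (cases "g (s n) (s (Suc n))") (auto simp: a)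
        have "a (Suc n) \<le> r"
          using a_le_g[of n] by (simp add: r)
        moreover have "2 * ereal r \<le> ereal (a n) + g (s n) v'"
          using g_half[OF that(2), of n] by (simp add: r a)
        ultimately show ?thesis
          using M[OF that(1)] by (cases "g (s n) v'") (auto simp: a)
      qed
      then show ?thesis
        by (intro exI[of _ "Suc M"]) (auto simp: u_def g_def)
    qed
    show ?thesis
      using mem chain small True
      by (intro exI[of _ "\<infinity>"] exI[of _ u]) (auto simp: u_def s0)
  next
    case False
    \<comment> \<open>The sequence stops at the first point without improvement, so it has
      \<open>N = Suc K\<close> terms.\<close>
    define K where "K = (LEAST n. \<not> improvable (s n))"
    have K: "\<not> improvable (s K)"
      unfolding K_def using False by (metis (mono_tags, lifting) LeastI)
    have before: "improvable (s i)" if "i < K" for i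
      using that not_less_Least unfolding K_def by blast
    have mem: "s n \<in> X" "\<phi> (s n) < \<infinity>" if "n \<le> K" for n
      using s_mem[of n] before that by auto
    have "\<phi> (s K) - ereal \<epsilon> < \<phi> v + \<eta> (v, s K)" if "0 < \<epsilon>" "v \<in> X" for \<epsilon> v
    proof -
      have "\<phi> (s K) \<le> \<phi> v + \<eta> (v, s K)"
        using K that by (auto simp: improvable_def g_def not_less)
      \<comment> \<open>Strictness rests on \<open>\<phi> (s K)\<close> being finite.\<close>
      moreover have "\<phi> (s K) - ereal \<epsilon> < \<phi> (s K)"
        using mem[of K] phi0[of "s K"] that by (cases "\<phi> (s K)") auto
      ultimately show ?thesis by order
    qed
    then have last: "\<exists>n. 1 \<le> n \<and> n \<le> Suc K \<and>
        (\<forall>u'\<in>X. \<forall>k. n \<le> k \<and> k \<le> Suc K \<longrightarrow> \<phi> (u k) - ereal \<epsilon> < \<phi> u' + \<eta> (u', u k))"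
      if "0 < \<epsilon>" for \<epsilon> :: real
      \<comment> \<open>Taking \<open>n = N\<close> works for every \<open>\<epsilon>\<close>: only
        the final index \<open>k = Suc K\<close> remains to be checked.\<close>
      using that by (intro exI[of _ "Suc K"]) (auto simp: u_def dest: antisym)
    show ?thesis
      using mem chain last before
      by (intro exI[of _ "enat (Suc K)"] exI[of _ u]) (auto simp: u_def s0 one_enat_def)
  qed
qed

end
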